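(* Let $C_\star>(3+\sqrt5)^2$, let $\kappa\ge2C_\star$, and let $(s,\beta)\in(0,\infty)\times(0,1)$ satisfy $$0<s<\frac{2(1+\beta)}{\kappa}\qquad\text{and}\qquad \rho_{\mathrm q}(s,\beta;\kappa)<q_\kappa=\frac{1-C_\star/\kappa}{1+C_\star/\kappa}.$$ Then there exists an integer $m\ge3$ with $$P_m(s,\beta;\kappa)<0 .$$
   Context: $A_\lambda(s,\beta)=\begin{pmatrix}1+\beta-s\lambda&-\beta\\1&0\end{pmatrix}$ and $\rho_{\mathrm q}(s,\beta;\kappa)=\max_{\lambda\in[1,\kappa]}\rho(A_\lambda(s,\beta))$, with $\rho(\cdot)$ the spectral radius. For an integer $m\ge3$, $\theta_m=2\pi/m$ and $$P_m(s,\beta;\kappa)=s^2-2\bigl[\beta-\cos\theta_m+\kappa^{-1}(1-\beta\cos\theta_m)\bigr]s+2\kappa^{-1}(1-\cos\theta_m)(1+\beta^2-2\beta\cos\theta_m).$$ *)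

theory Defs
  imports Complex_Main "Jordan_Normal_Form.Spectral_Radius"
begin

definition A_mat :: "real \<Rightarrow> real \<Rightarrow> real \<Rightarrow> real mat" where
  "A_mat lam s \<beta> = mat_of_rows_list 2
     [[1 + \<beta> - s * lam, - \<beta>],
      [1, 0]]"

(* The library's spectral_radius is defined for complex matrices only, so the real
   matrix is embedded entrywise; its complex eigenvalues are the ones that count.
   The maximum over the compact interval [1, kappa] is written as a supremum: the
   spectral radius is continuous in lam, so for kappa >= 1 the supremum is finite
   and attained. *)
definition rho_q :: "real \<Rightarrow> real \<Rightarrow> real \<Rightarrow> real" where
  "rho_q s \<beta> \<kappa> =
     (SUP lam\<in>{1..\<kappa>}. spectral_radius (map_mat complex_of_real (A_mat lam s \<beta>)))"

definition theta :: "nat \<Rightarrow> real" where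
  "theta m = 2 * pi / real m"

definition P :: "nat \<Rightarrow> real \<Rightarrow> real \<Rightarrow> real \<Rightarrow> real" where
  "P m s \<beta> \<kappa> =
     s\<^sup>2 - 2 * (\<beta> - cos (theta m) + inverse \<kappa> * (1 - \<beta> * cos (theta m))) * s
     + 2 * inverse \<kappa> * (1 - cos (theta m)) * (1 + \<beta>\<^sup>2 - 2 * \<beta> * cos (theta m))"

end

theory Submission
  imports Defs
begin

text \<open>
  Write \<open>y = s * \<kappa>\<close> and \<open>x = 1 - cos (theta m)\<close>. The proof combines a lower bound on \<open>y\<close>,
  forced by the contraction rate, with the fact that \<open>P m s \<beta> \<kappa>\<close> is a convex quadratic
  in \<open>x\<close> whose interval of negativity is wide when \<open>y\<close> is large compared with \<open>1 - \<beta>\<close>.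

  If all roots of \<open>z\<^sup>2 - (1 + \<beta> - s) * z + \<beta>\<close>, the characteristic polynomial of
  \<open>A_mat 1 s \<beta>\<close>, lie in the disc of radius \<open>q < 1\<close>, then \<open>\<beta> < q\<^sup>2\<close> and the polynomial is
  positive at \<open>q\<close>. Together these give \<open>s > (1 - q) / (1 + q) * (1 - \<beta>)\<close>
  (\<open>step_size_lower_bound\<close>). For \<open>q = (1 - C / \<kappa>) / (1 + C / \<kappa>)\<close> the factor is
  \<open>C / \<kappa>\<close>, so the bound says \<open>y > C * (1 - \<beta>)\<close>.

  On the other hand, \<open>\<kappa> * P m s \<beta> \<kappa>\<close> is at most \<open>4 * x\<^sup>2 - 2 * x * y\<close> plus terms that are
  bounded by \<open>y * (1 - \<beta>)\<close> and \<open>y\<^sup>2 / \<kappa>\<close> up to constants. Since \<open>C > 25\<close> and \<open>\<kappa> > 50\<close>, these are small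
  multiples of \<open>y\<^sup>2\<close>, and \<open>P m s \<beta> \<kappa>\<close> is negative for every \<open>x\<close> between \<open>y / 10\<close> and
  \<open>2 * y / 5\<close> (\<open>P_neg_of_window\<close>). The ratio of these endpoints is four, which is wide
  enough for some angle \<open>theta m\<close> to fall in the window (\<open>ex_theta_in_window\<close>). The upper
  bound on \<open>s\<close> gives \<open>y < 4\<close>, so the window is not entirely above \<open>3 / 2\<close>, the value
  of \<open>x\<close> for \<open>m = 3\<close>.
\<close>

section \<open>The spectrum of the iteration matrix\<close>

lemma A_mat_carrier: "map_mat complex_of_real (A_mat lam s \<beta>) \<in> carrier_mat 2 2"
  by (simp add: A_mat_def mat_of_rows_list_def numeral_2_eq_2)

lemma eigenvalue_A_mat_iff:
  "eigenvalue (map_mat complex_of_real (A_mat lam s \<beta>)) z \<longleftrightarrow>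
     z\<^sup>2 - complex_of_real (1 + \<beta> - s * lam) * z + complex_of_real \<beta> = 0"
  (is "eigenvalue ?A z \<longleftrightarrow> ?p = 0")
proof -
  have A: "?A \<in> carrier_mat 2 2"
    by (rule A_mat_carrier)
  have prod: "?A *\<^sub>v v =
      vec 2 (\<lambda>i. if i = 0 then complex_of_real (1 + \<beta> - s * lam) * v $ 0 - complex_of_real \<beta> * v $ 1
                else v $ 0)" if "v \<in> carrier_vec 2" for v
    using that
    by (intro eq_vecI)
       (auto simp: A_mat_def mat_of_rows_list_def scalar_prod_def row_def
          numeral_2_eq_2 less_Suc_eq)
  show ?thesis
  proof
    assume "eigenvalue ?A z"
    then obtain v where v: "v \<in> carrier_vec 2" "v \<noteq> 0\<^sub>v 2" "?A *\<^sub>v v = z \<cdot>\<^sub>v v"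
      using A unfolding eigenvalue_def eigenvector_def by auto
    have "(?A *\<^sub>v v) $ 0 = z * v $ 0" "(?A *\<^sub>v v) $ 1 = z * v $ 1"
      using v by auto
    then have e: "complex_of_real (1 + \<beta> - s * lam) * v $ 0 - complex_of_real \<beta> * v $ 1 = z * v $ 0"
        "v $ 0 = z * v $ 1"
      unfolding prod[OF v(1)] by auto
    have "v $ 1 \<noteq> 0"
    proof
      assume "v $ 1 = 0"
      with e(2) v(1) have "v = 0\<^sub>v 2"
        by (intro eq_vecI) (auto simp: numeral_2_eq_2 less_Suc_eq)
      with v(2) show False ..
    qed
    moreover have "?p * v $ 1 = 0"
      using e by (simp add: algebra_simps power2_eq_square)
    ultimately show "?p = 0" by simp
  next
    assume p: "?p = 0"
    define v where "v = vec 2 (\<lambda>i. if i = 0 then z else (1::complex))"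
    have v: "v \<in> carrier_vec 2" by (simp add: v_def)
    have "v $ 1 = 1" by (simp add: v_def)
    then have "v \<noteq> 0\<^sub>v 2" by auto
    moreover have "?A *\<^sub>v v = z \<cdot>\<^sub>v v"
      unfolding prod[OF v] using p
      by (intro eq_vecI) (auto simp: v_def algebra_simps power2_eq_square)
    ultimately show "eigenvalue ?A z"
      using A v unfolding eigenvalue_def eigenvector_def by auto
  qed
qed

lemma norm_le_spectral_radius_A_mat:
  assumes "z\<^sup>2 - complex_of_real (1 + \<beta> - s * lam) * z + complex_of_real \<beta> = 0"
  shows "norm z \<le> spectral_radius (map_mat complex_of_real (A_mat lam s \<beta>))"
proof -
  have "map_mat complex_of_real (A_mat lam s \<beta>) \<in> carrier_mat 2 2"
    by (rule A_mat_carrier)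
  moreover have "norm z \<in> norm ` spectrum (map_mat complex_of_real (A_mat lam s \<beta>))"
    using assms by (simp add: spectrum_def eigenvalue_A_mat_iff)
  ultimately show ?thesis
    using spectral_radius_mem_max(2)[of _ 2] by auto
qed

text \<open>A supremum of reals bounds its family only if the family is bounded above; the
  eigenvalues are bounded uniformly in \<open>lam\<close> because the coefficients of the
  characteristic polynomial are.\<close>

lemma spectral_radius_le_rho_q:
  assumes "lam \<in> {1..\<kappa>}"
  shows "spectral_radius (map_mat complex_of_real (A_mat lam s \<beta>)) \<le> rho_q s \<beta> \<kappa>"
proof -
  define R where "R = 1 + (1 + \<bar>\<beta>\<bar> + \<bar>s\<bar> * \<kappa>) + \<bar>\<beta>\<bar>"
  have "spectral_radius (map_mat complex_of_real (A_mat l s \<beta>)) \<le> R" if l: "l \<in> {1..\<kappa>}" for l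
  proof -
    have "map_mat complex_of_real (A_mat l s \<beta>) \<in> carrier_mat 2 2"
      by (rule A_mat_carrier)
    then obtain z where z: "z \<in> spectrum (map_mat complex_of_real (A_mat l s \<beta>))"
        "spectral_radius (map_mat complex_of_real (A_mat l s \<beta>)) = norm z"
      using spectral_radius_mem_max(1)[of "map_mat complex_of_real (A_mat l s \<beta>)" 2] by auto
    define t where "t = 1 + \<beta> - s * l"
    have "\<bar>s\<bar> * l \<le> \<bar>s\<bar> * \<kappa>" using l by (simp add: mult_left_mono)
    then have t: "\<bar>t\<bar> \<le> 1 + \<bar>\<beta>\<bar> + \<bar>s\<bar> * \<kappa>"
      using abs_mult[of s l] l unfolding t_def by simp
    have "z\<^sup>2 - complex_of_real t * z + complex_of_real \<beta> = 0"
      using z(1) by (simp add: spectrum_def eigenvalue_A_mat_iff t_def)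
    then have "z\<^sup>2 = complex_of_real t * z - complex_of_real \<beta>"
      by (simp add: algebra_simps add_eq_0_iff)
    then have "norm z ^ 2 = norm (complex_of_real t * z - complex_of_real \<beta>)"
      by (metis norm_power)
    also have "\<dots> \<le> \<bar>t\<bar> * norm z + \<bar>\<beta>\<bar>"
      using norm_triangle_ineq4[of "complex_of_real t * z" "complex_of_real \<beta>"]
      by (simp add: norm_mult)
    finally have q: "norm z * norm z \<le> \<bar>t\<bar> * norm z + \<bar>\<beta>\<bar>"
      by (simp add: power2_eq_square)
    have "norm z \<le> 1 + \<bar>t\<bar> + \<bar>\<beta>\<bar>"
    proof (cases "norm z \<le> 1")
      case False
      then have "\<bar>\<beta>\<bar> \<le> \<bar>\<beta>\<bar> * norm z" by (simp add: mult_le_cancel_left1)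
      with q have "norm z * norm z \<le> (\<bar>t\<bar> + \<bar>\<beta>\<bar>) * norm z" by (simp add: algebra_simps)
      moreover have "0 < norm z" using False by linarith
      ultimately have "norm z \<le> \<bar>t\<bar> + \<bar>\<beta>\<bar>" by (rule mult_right_le_imp_le)
      then show ?thesis by simp
    qed simp
    with t z(2) show ?thesis by (simp add: R_def)
  qed
  then have "bdd_above ((\<lambda>l. spectral_radius (map_mat complex_of_real (A_mat l s \<beta>))) ` {1..\<kappa>})"
    by (intro bdd_aboveI2[where M = R])
  with assms show ?thesis unfolding rho_q_def by (intro cSUP_upper)
qed

text \<open>This is Schur's stability criterion for the disc of radius \<open>q\<close>, in the
  direction used here: the product of the roots is \<open>d\<close>, and a monic real quadratic that
  is not positive at \<open>q\<close> has a real root at \<open>q\<close> or to its right.\<close>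

lemma roots_in_disc_imp:
  fixes t d q :: real
  assumes roots: "\<And>z. z\<^sup>2 - complex_of_real t * z + complex_of_real d = 0 \<Longrightarrow> norm z < q"
  shows "d < q\<^sup>2" and "0 < q\<^sup>2 - t * q + d"
proof -
  define w where "w = csqrt (complex_of_real (t\<^sup>2 - 4 * d))"
  define z1 where "z1 = (complex_of_real t + w) / 2"
  define z2 where "z2 = (complex_of_real t - w) / 2"
  have w2: "w * w = complex_of_real t * complex_of_real t - 4 * complex_of_real d"
    using power2_csqrt[of "complex_of_real (t\<^sup>2 - 4 * d)"]
    by (simp add: w_def power2_eq_square)
  have "norm z1 < q" "norm z2 < q"
    by (rule roots, simp add: z1_def z2_def field_simps power2_eq_square w2)+
  then have "norm z1 * norm z2 < q * q"
    by (intro mult_strict_mono') auto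
  moreover have "z1 * z2 = complex_of_real d"
    by (simp add: z1_def z2_def field_simps w2)
  ultimately have "norm (complex_of_real d) < q\<^sup>2"
    by (metis norm_mult power2_eq_square)
  then show "d < q\<^sup>2" by simp
  show "0 < q\<^sup>2 - t * q + d"
  proof (rule ccontr)
    assume "\<not> 0 < q\<^sup>2 - t * q + d"
    then have "(2 * q - t)\<^sup>2 \<le> t\<^sup>2 - 4 * d"
      by (simp add: power2_eq_square algebra_simps)
    moreover from this have "0 \<le> t\<^sup>2 - 4 * d"
      using zero_le_power2[of "2 * q - t"] by linarith
    moreover define D where "D = sqrt (t\<^sup>2 - 4 * d)"
    ultimately have D: "D\<^sup>2 = t\<^sup>2 - 4 * d" and "2 * q - t \<le> D"
      by (auto intro: real_le_rsqrt)
    define x where "x = (t + D) / 2"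
    have "q \<le> x" using \<open>2 * q - t \<le> D\<close> by (simp add: x_def)
    have "x\<^sup>2 - t * x + d = 0"
      using D by (simp add: x_def field_simps power2_eq_square)
    then have "complex_of_real (x\<^sup>2 - t * x + d) = 0" by simp
    then have "norm (complex_of_real x) < q"
      by (intro roots) simp
    with \<open>q \<le> x\<close> show False by simp
  qed
qed

text \<open>The constraint comes from \<open>lam = 1\<close>, where the iteration contracts slowly if \<open>s\<close> is
  small. There, positivity of the characteristic polynomial at \<open>q\<close> reads
  \<open>q * s > (1 - q) * (q - \<beta>)\<close>, and \<open>\<beta> < q\<^sup>2\<close> gives \<open>(1 + q) * (q - \<beta>) > q * (1 - \<beta>)\<close>.\<close>

lemma step_size_lower_bound:
  assumes "rho_q s \<beta> \<kappa> < q" and "1 \<le> \<kappa>" and "0 < q" and "q < 1"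
  shows "(1 - q) * (1 - \<beta>) < s * (1 + q)"
proof -
  have sr: "spectral_radius (map_mat complex_of_real (A_mat 1 s \<beta>)) < q"
    using spectral_radius_le_rho_q[of 1 \<kappa> s \<beta>] assms(1,2) by simp
  have "norm z < q" if "z\<^sup>2 - complex_of_real (1 + \<beta> - s) * z + complex_of_real \<beta> = 0" for z
    using norm_le_spectral_radius_A_mat[of z \<beta> s 1] that sr by simp
  note schur = roots_in_disc_imp[of "1 + \<beta> - s" \<beta> q, OF this]
  have "(1 - q) * (q * (1 - \<beta>)) < (1 - q) * ((1 + q) * (q - \<beta>))"
    using schur(1) assms(4)
    by (intro mult_strict_left_mono) (auto simp: algebra_simps power2_eq_square)
  also have "\<dots> = (1 + q) * ((1 - q) * (q - \<beta>))" by simp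
  also have "\<dots> < (1 + q) * (q * s)"
    using schur(2) assms(3)
    by (intro mult_strict_left_mono) (auto simp: algebra_simps power2_eq_square)
  finally have "q * ((1 - q) * (1 - \<beta>)) < q * (s * (1 + q))"
    by (simp add: mult_ac)
  with assms(3) show ?thesis by simp
qed

section \<open>The angles\<close>

text \<open>Halving an angle divides \<open>1 - cos\<close> by at most four, so along \<open>m = 3 * 2 ^ j\<close> the values
  of \<open>1 - cos (theta m)\<close> descend from \<open>3 / 2\<close> to zero without skipping any interval that
  meets this range and whose endpoints have ratio four.\<close>

lemma ex_theta_in_window:
  assumes "0 < X" and "X \<le> 6"
  shows "\<exists>m\<ge>3. X / 4 \<le> 1 - cos (theta m) \<and> 1 - cos (theta m) \<le> X"
proof -
  define x where "x = (\<lambda>j. 1 - cos (theta (3 * 2 ^ j)))"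
  have "(\<lambda>j. 2 * pi / 3 * (1 / 2) ^ j) \<longlonglongrightarrow> 2 * pi / 3 * 0"
    by (intro tendsto_mult_left LIMSEQ_power_zero) simp
  then have "(\<lambda>j. theta (3 * 2 ^ j)) \<longlonglongrightarrow> 0"
    by (simp add: theta_def power_one_over divide_simps)
  then have "x \<longlonglongrightarrow> 1 - cos 0"
    unfolding x_def by (intro tendsto_diff tendsto_const tendsto_cos)
  then have "\<forall>\<^sub>F j in sequentially. x j < X"
    using assms(1) by (intro order_tendstoD) auto
  then obtain j0 where "x j0 \<le> X"
    by (metis eventually_sequentially order_less_imp_le order_refl)
  define j where "j = (LEAST j. x j \<le> X)"
  have le: "x j \<le> X" unfolding j_def using \<open>x j0 \<le> X\<close> by (rule LeastI)
  have ge: "X / 4 \<le> x j"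
  proof (cases j)
    case 0
    then show ?thesis
      using assms(2) by (simp add: x_def theta_def cos_120)
  next
    case (Suc i)
    then have "X < x i"
      unfolding j_def using not_less_Least[of i "\<lambda>j. x j \<le> X"] by (simp add: j_def)
    define \<phi> where "\<phi> = theta (3 * 2 ^ j)"
    have "theta (3 * 2 ^ i) = 2 * \<phi>"
      by (simp add: theta_def \<phi>_def Suc)
    then have "x i = 2 * (1 - cos \<phi>) * (1 + cos \<phi>)"
      using cos_double_cos[of \<phi>] by (simp add: x_def algebra_simps power2_eq_square)
    also have "\<dots> \<le> 2 * (1 - cos \<phi>) * 2"
      by (intro mult_left_mono) auto
    finally have "x i \<le> 4 * x j" by (simp add: x_def \<phi>_def)
    with \<open>X < x i\<close> show ?thesis by simp
  qed
  have "(3::nat) \<le> 3 * 2 ^ j" by simp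
  with le ge show ?thesis unfolding x_def by blast
qed

section \<open>Negativity of the quadratic\<close>

lemma P_times_kappa:
  assumes "\<kappa> \<noteq> 0" and "x = 1 - cos (theta m)"
  shows "\<kappa> * P m s \<beta> \<kappa> =
    4 * \<beta> * x\<^sup>2 + 2 * x * ((1 - \<beta>)\<^sup>2 - s * \<kappa> - \<beta> * s)
      + s * (s * \<kappa>) + 2 * (1 - \<beta>) * (s * \<kappa>) - 2 * (1 - \<beta>) * s"
proof -
  have c: "cos (theta m) = 1 - x" using assms(2) by simp
  \<comment> \<open>The products \<open>\<kappa> * inverse \<kappa>\<close> are collected before they are replaced by one.\<close>
  have "\<kappa> * P m s \<beta> \<kappa> =
      \<kappa> * s\<^sup>2 - 2 * \<kappa> * (\<beta> - (1 - x)) * s - 2 * (\<kappa> * inverse \<kappa>) * (1 - \<beta> * (1 - x)) * s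
        + 2 * (\<kappa> * inverse \<kappa>) * x * (1 + \<beta>\<^sup>2 - 2 * \<beta> * (1 - x))"
    unfolding P_def c by (simp only: algebra_simps)
  also have "\<kappa> * inverse \<kappa> = 1" using assms(1) by simp
  finally show ?thesis by (simp add: algebra_simps power2_eq_square)
qed

text \<open>With \<open>y = s * \<kappa>\<close>, the dominant part of \<open>\<kappa> * P m s \<beta> \<kappa>\<close> is \<open>4 * x\<^sup>2 - 2 * x * y\<close>, whose minimum is
  at \<open>x = y / 4\<close>. The window from \<open>y / 10\<close> to \<open>2 * y / 5\<close> is symmetric about
  that point, and its endpoints give the value \<open>- 4 * y\<^sup>2 / 25\<close>; the hypotheses make
  the remaining terms at most \<open>(4 / 125 + 1 / 50 + 2 / 25) * y\<^sup>2\<close>, which is smaller.\<close>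

lemma P_neg_of_window:
  assumes "0 < \<beta>" "\<beta> < 1" "0 < s" "50 \<le> \<kappa>"
    and y: "25 * (1 - \<beta>) \<le> s * \<kappa>"
    and lower: "s * \<kappa> / 10 \<le> 1 - cos (theta m)"
    and upper: "1 - cos (theta m) \<le> 2 * (s * \<kappa>) / 5"
  shows "P m s \<beta> \<kappa> < 0"
proof -
  define x where "x = 1 - cos (theta m)"
  define y where "y = s * \<kappa>"
  define \<delta> where "\<delta> = 1 - \<beta>"
  have y0: "0 < y" using assms by (simp add: y_def)
  have x0: "0 \<le> x" by (simp add: x_def)
  have d: "0 < \<delta>" "\<delta> < 1" "\<delta> \<le> y / 25" using assms by (auto simp: \<delta>_def y_def)
  have main: "4 * x\<^sup>2 - 2 * x * y \<le> - (4 / 25) * y\<^sup>2"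
  proof -
    have "(x - y / 10) * (x - 2 * y / 5) \<le> 0"
      using lower upper by (intro mult_nonneg_nonpos) (auto simp: x_def y_def)
    moreover have "4 * x\<^sup>2 - 2 * x * y + 4 / 25 * y\<^sup>2 = 4 * ((x - y / 10) * (x - 2 * y / 5))"
      by (simp add: power2_eq_square field_simps)
    ultimately show ?thesis by linarith
  qed
  have lead: "4 * \<beta> * x\<^sup>2 \<le> 4 * x\<^sup>2"
    using mult_right_mono[of \<beta> 1 "x\<^sup>2"] assms(2) by simp
  have dy: "\<delta> * y \<le> y\<^sup>2 / 25"
    using mult_right_mono[OF d(3), of y] y0 by (simp add: power2_eq_square)
  have ddx: "2 * x * \<delta>\<^sup>2 \<le> 4 / 5 * (\<delta> * y)"
  proof -
    have "\<delta>\<^sup>2 \<le> \<delta>" using d by (simp add: power2_eq_square mult_le_cancel_left2)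
    then have "x * \<delta>\<^sup>2 \<le> (2 * y / 5) * \<delta>"
      using upper x0 d y0 by (intro mult_mono) (auto simp: x_def y_def)
    then show ?thesis by (simp add: mult_ac)
  qed
  have sy: "s * y \<le> y\<^sup>2 / 50"
  proof -
    have "s \<le> y / 50" using mult_left_mono[OF assms(4), of s] assms(3) by (simp add: y_def)
    then show ?thesis
      using mult_right_mono[of s "y / 50" y] y0 by (simp add: power2_eq_square)
  qed
  have neg: "0 \<le> x * (\<beta> * s)" "0 \<le> \<delta> * s" using assms d x0 by auto
  have "\<kappa> * P m s \<beta> \<kappa> =
      4 * \<beta> * x\<^sup>2 + 2 * x * (\<delta>\<^sup>2 - y - \<beta> * s) + s * y + 2 * \<delta> * y - 2 * \<delta> * s"
    using P_times_kappa[of \<kappa> x m s \<beta>] assms(4) by (simp add: x_def y_def \<delta>_def)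
  also have "\<dots> = 4 * \<beta> * x\<^sup>2 - 2 * x * y + 2 * x * \<delta>\<^sup>2 + s * y + 2 * (\<delta> * y)
      - 2 * (x * (\<beta> * s)) - 2 * (\<delta> * s)"
    by (simp add: algebra_simps)
  also have "\<dots> \<le> - (4 / 25) * y\<^sup>2 + 4 / 5 * (y\<^sup>2 / 25) + y\<^sup>2 / 50 + 2 * (y\<^sup>2 / 25)"
    using main lead dy ddx sy neg by linarith
  also have "\<dots> < 0" using y0 by simp
  finally show ?thesis
    using assms(4) by (simp add: mult_less_0_iff)
qed

theorem lemma3p3:
  fixes C \<kappa> s \<beta> :: real
  assumes "C > (3 + sqrt 5)\<^sup>2"
    and "\<kappa> \<ge> 2 * C"
    and "0 < \<beta>" and "\<beta> < 1"
    and "0 < s" and "s < 2 * (1 + \<beta>) / \<kappa>"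
    and "rho_q s \<beta> \<kappa> < (1 - C / \<kappa>) / (1 + C / \<kappa>)"
  shows "\<exists>m::nat. m \<ge> 3 \<and> P m s \<beta> \<kappa> < 0"
proof -
  have "(5::real)\<^sup>2 \<le> (3 + sqrt 5)\<^sup>2"
    by (intro power_mono) (auto intro: real_le_rsqrt)
  then have C: "25 < C" using assms(1) by simp
  then have \<kappa>: "50 < \<kappa>" using assms(2) by simp
  define \<epsilon> where "\<epsilon> = C / \<kappa>"
  have \<epsilon>: "0 < \<epsilon>" "\<epsilon> < 1" using C \<kappa> assms(2) by (auto simp: \<epsilon>_def)
  define q where "q = (1 - \<epsilon>) / (1 + \<epsilon>)"
  have q: "0 < q" "q < 1" "1 - q = \<epsilon> * (1 + q)"
    using \<epsilon> by (auto simp: q_def field_simps)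
  have "(1 - q) * (1 - \<beta>) < s * (1 + q)"
    using assms(7) \<kappa> q by (intro step_size_lower_bound[of _ _ \<kappa>]) (auto simp: q_def \<epsilon>_def)
  then have "(\<epsilon> * (1 - \<beta>)) * (1 + q) < s * (1 + q)"
    unfolding q(3) by (simp add: mult_ac)
  then have "\<epsilon> * (1 - \<beta>) < s" using q by (simp add: mult_less_cancel_right)
  then have "C * (1 - \<beta>) < s * \<kappa>"
    using \<kappa> by (simp add: \<epsilon>_def field_simps)
  moreover have "25 * (1 - \<beta>) \<le> C * (1 - \<beta>)"
    using C assms(4) by (intro mult_right_mono) auto
  ultimately have y: "25 * (1 - \<beta>) \<le> s * \<kappa>" by simp
  have "s * \<kappa> < 2 * (1 + \<beta>)"
    using assms(6) \<kappa> by (simp add: field_simps)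
  then have "s * \<kappa> < 4" using assms(4) by simp
  moreover have "0 < s * \<kappa>" using assms(5) \<kappa> by simp
  ultimately have "0 < 2 * (s * \<kappa>) / 5" "2 * (s * \<kappa>) / 5 \<le> 6" by linarith+
  then obtain m where m: "m \<ge> 3" "2 * (s * \<kappa>) / 5 / 4 \<le> 1 - cos (theta m)"
      "1 - cos (theta m) \<le> 2 * (s * \<kappa>) / 5"
    using ex_theta_in_window by blast
  have "P m s \<beta> \<kappa> < 0"
    using m y \<kappa> assms(3-5) by (intro P_neg_of_window) (auto simp: mult.commute)
  with m(1) show ?thesis by blast
qed

end
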